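(* For residually defined $g$-functions $g$ of property $(D)$ subshifts, finiteness and countable infinity of the range of the mapping $$x_{(-\infty,0]}\mapsto\mu_0^{(g)}(x_{(-\infty,0]})\qquad(x\in E(g))$$ are invariants of topological conjugacy. That is: let $X\subset\Sigma^{\mathbb Z}$ and $\widetilde X\subset\widetilde\Sigma^{\mathbb Z}$ be property $(D)$ subshifts, $g$ a residually defined $g$-function of $X$, $\widetilde g$ a residually defined $g$-function of $\widetilde X$, and suppose $\widetilde g$ is the image of $g$ under a topological conjugacy $\varphi:X\to\widetilde X$. Then $\{\mu_0^{(g)}(x_{(-\infty,0]}):x\in E(g)\}$ is finite if and only if $\{\mu_0^{(\widetilde g)}(\widetilde x_{(-\infty,0]}):\widetilde x\in E(\widetilde g)\}$ is finite, and the former is countably infinite if and only if the latter is countably infinite. (Here $\mu_0^{(g)}(x_{(-\infty,0]})$ is regarded as a probability measure on $\Sigma^{\mathbb N}$ via $y\mapsto y_{[1,\infty)}$, and similarly for $\widetilde g$.)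
   Context: Subshifts. $\Sigma,\widetilde\Sigma$ are finite alphabets, $S$ is the shift, $(Sx)_i=x_{i+1}$. A subshift is a closed $S$-invariant set $X\subset\Sigma^{\mathbb Z}$; a finite word is admissible if it appears in some point of $X$. For an interval $J\subset\mathbb Z$, $x_J=(x_j)_{j\in J}$ and $X_J=\{x_J:x\in X\}$ with the product topology; blocks are identified with words up to translation of indices. A topological conjugacy is a shift-commuting homeomorphism. A set is residual if it contains a dense $G_\delta$. For $x^-\in X_{(-\infty,i]}$, $\Gamma_n^+(x^-)$ is the set of words $b$ of length $n$ with $(x^-,b)\in X_{(-\infty,i+n]}$. For an admissible word $a$, $\Gamma^-(a)$ is the set of finite words $c$ with $ca$ admissible, $\Gamma_\infty^-(a)$ is the set of left-infinite sequences $x^-$ such that $(x^-,a)$ is, up to translation, in $X_{(-\infty,0]}$, and $\omega_n^+(a)$ is the set of words $b$ of length $n$ such that $(x^-,a,b)$ is, up to translation, in $X_{(-\infty,0]}$ for all $x^-\in\Gamma_\infty^-(a)$. Property $(D)$: for every admissible word $b\sigma$ ($\sigma\in\Sigma$) there is $a\in\Gamma^-(b)$ with $\sigma\in\omega_1^+(ab)$. Residually defined $g$-function of $X$: a continuous function $g:D^-(g)\times\Sigma\to[0,1]$, $D^-(g)$ residual in $X_{(-\infty,0]}$, such that (i) $\sum_{\sigma\in\Gamma_1^+(x^-)}g(x^-,\sigma)=1$ for $x^-\in D^-(g)$, and $g(x^-,\sigma)=0$ if $\sigma\notin\Gamma_1^+(x^-)$; (ii) there is no point of $X_{(-\infty,0]}\setminus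 D^-(g)$ to which $x^-\mapsto(g(x^-,\sigma))_{\sigma\in\Sigma}$ can be extended by continuity; (iii) $X_{(-\infty,1]}=\overline{\{(x^-,\alpha):x^-\in D^-(g),\alpha\in\Gamma_1^+(x^-),g(x^-,\alpha)>0\}}$. By translation, $g(x^-,\alpha)$ is also used for $x^-\in S^{-i}D^-(g)\subset X_{(-\infty,i]}$. The set $E(g)$: the set of $x\in X$ such that for all $i\in\mathbb Z$: $x_{(-\infty,i]}\in S^{-i}D^-(g)$, $g(x_{(-\infty,i]},x_{i+1})>0$, and for all $k\in\mathbb N$ and all $a\in\Gamma_k^+(x_{(-\infty,i]})$, $(x_{(-\infty,i]},a)\in S^{-i-k}D^-(g)$. Measures. For $x\in E(g)$, $i\in\mathbb Z$: $F_i(x)=\{y\in X:y_{(-\infty,i]}=x_{(-\infty,i]}\}$, $F_i(x,a)=\{y\in F_i(x):y_{(i,i+n]}=a\}$, and $\mu_i^{(g)}(x_{(-\infty,i]})$ is the Borel probability measure on $F_i(x)$ with $$\mu_i^{(g)}(x_{(-\infty,i]})(F_i(x,a))=\prod_{1\le k\le N}g\big((x_{(-\infty,i]},a_1\cdots a_{k-1}),a_k\big)$$ for $a=a_1\cdots a_N\in\Gamma_N^+(x_{(-\infty,i]})$, $N\in\mathbb N$. There is a $\sigma$-finite measure $\lambda_x^{(g)}$ on $\bigcup_{k\in\mathbb N}F_{-k}(x)$, unique up to multiplication by a positive constant, such that for all $i\in\mathbb Z$: $0<\lambda_x^{(g)}(F_i(x))<\infty$ and $\lambda_x^{(g)}|_{F_i(x)}/\lambda_x^{(g)}(F_i(x))=\mu_i^{(g)}(x_{(-\infty,i]})$.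 Image. $\widetilde g$ is the image of $g$ under the topological conjugacy $\varphi:X\to\widetilde X$ if $\varphi(E(g))=E(\widetilde g)$ and, for all $x\in E(g)$, the image under $\varphi^{-1}$ of $\lambda^{(\widetilde g)}_{\varphi(x)}$ is a positive scalar multiple of $\lambda_x^{(g)}$. *)

theory Defs
  imports "HOL-Probability.Probability"
begin

text \<open>
  An alphabet is a type of class \<open>finite\<close>.  For \<open>J \<subseteq> \<int>\<close>, a block over \<open>J\<close> is a function
  \<open>int \<Rightarrow> 'a\<close> that is extensional on \<open>J\<close>; so \<open>x\<^sub>J\<close> is \<open>restrict x J\<close>, and \<open>J = UNIV\<close> gives the
  bi-infinite sequences.
\<close>

definition seqtop :: "int set \<Rightarrow> (int \<Rightarrow> 'a) topology" where
  "seqtop J = product_topology (\<lambda>_. discrete_topology UNIV) J"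

definition blocks :: "(int \<Rightarrow> 'a) set \<Rightarrow> int set \<Rightarrow> (int \<Rightarrow> 'a) set" where
  "blocks X J = (\<lambda>x. restrict x J) ` X"

text \<open>
  \<open>shift k\<close> is the \<open>k\<close>-th power of the shift.  It is also the translation of blocks: it carries
  functions extensional on \<open>{..i}\<close> to functions extensional on \<open>{..i - k}\<close>.
\<close>

definition shift :: "int \<Rightarrow> (int \<Rightarrow> 'a) \<Rightarrow> (int \<Rightarrow> 'a)" where
  "shift k x = (\<lambda>j. x (j + k))"

definition subshift :: "(int \<Rightarrow> 'a::finite) set \<Rightarrow> bool" where
  "subshift X \<longleftrightarrow> closedin (seqtop UNIV) X \<and> shift 1 ` X = X"

definition conjugacy ::
  "(int \<Rightarrow> 'a::finite) set \<Rightarrow> (int \<Rightarrow> 'b::finite) set \<Rightarrow> ((int \<Rightarrow> 'a) \<Rightarrow> (int \<Rightarrow> 'b)) \<Rightarrow> bool"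
  where
  "conjugacy X Y \<phi> \<longleftrightarrow>
     homeomorphic_map (subtopology (seqtop UNIV) X) (subtopology (seqtop UNIV) Y) \<phi> \<and>
     (\<forall>x\<in>X. \<phi> (shift 1 x) = shift 1 (\<phi> x))"

text \<open>\<open>word i n x\<close> is the block of \<open>x\<close> over \<open>{i<..i + n}\<close>, read as a word.\<close>

definition word :: "int \<Rightarrow> nat \<Rightarrow> (int \<Rightarrow> 'a) \<Rightarrow> 'a list" where
  "word i n x = map (\<lambda>k. x (i + 1 + int k)) [0..<n]"

definition admissible :: "(int \<Rightarrow> 'a) set \<Rightarrow> 'a list \<Rightarrow> bool" where
  "admissible X w \<longleftrightarrow> (\<exists>x\<in>X. \<exists>i. word i (length w) x = w)"

text \<open>
  \<open>app i x a\<close> is \<open>(x, a)\<close> for a left ray \<open>x\<close> over \<open>{..i}\<close>; the result is a left ray over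
  \<open>{..i + length a}\<close>.
\<close>

definition app :: "int \<Rightarrow> (int \<Rightarrow> 'a) \<Rightarrow> 'a list \<Rightarrow> (int \<Rightarrow> 'a)" where
  "app i x a =
     (\<lambda>j\<in>{..i + int (length a)}. if j \<le> i then x j else a ! nat (j - i - 1))"

definition Gamma_plus :: "(int \<Rightarrow> 'a) set \<Rightarrow> int \<Rightarrow> nat \<Rightarrow> (int \<Rightarrow> 'a) \<Rightarrow> 'a list set" where
  "Gamma_plus X i n x = {b. length b = n \<and> app i x b \<in> blocks X {..i + int n}}"

definition Gamma_minus :: "(int \<Rightarrow> 'a) set \<Rightarrow> 'a list \<Rightarrow> 'a list set" where
  "Gamma_minus X a = {c. admissible X (c @ a)}"

definition Gamma_minus_inf :: "(int \<Rightarrow> 'a) set \<Rightarrow> 'a list \<Rightarrow> (int \<Rightarrow> 'a) set" where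
  "Gamma_minus_inf X a =
     {x \<in> extensional {..0}. shift (int (length a)) (app 0 x a) \<in> blocks X {..0}}"

definition omega_plus :: "(int \<Rightarrow> 'a) set \<Rightarrow> nat \<Rightarrow> 'a list \<Rightarrow> 'a list set" where
  "omega_plus X n a =
     {b. length b = n \<and>
         (\<forall>x\<in>Gamma_minus_inf X a.
            shift (int (length (a @ b))) (app 0 x (a @ b)) \<in> blocks X {..0})}"

definition property_D :: "(int \<Rightarrow> 'a) set \<Rightarrow> bool" where
  "property_D X \<longleftrightarrow>
     (\<forall>b \<sigma>. admissible X (b @ [\<sigma>]) \<longrightarrow>
        (\<exists>a\<in>Gamma_minus X b. [\<sigma>] \<in> omega_plus X 1 (a @ b)))"

definition residual_in :: "'c topology \<Rightarrow> 'c set \<Rightarrow> bool" where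
  "residual_in T A \<longleftrightarrow>
     A \<subseteq> topspace T \<and> (\<exists>G\<subseteq>A. gdelta_in T G \<and> T closure_of G = topspace T)"

text \<open>
  A residually defined \<open>g\<close>-function is given by its domain \<open>D\<close> together with a function \<open>g\<close>, whose
  values at left rays outside \<open>D\<close> are irrelevant.
\<close>

definition residual_g_function ::
  "(int \<Rightarrow> 'a::finite) set \<Rightarrow> (int \<Rightarrow> 'a) set \<Rightarrow> ((int \<Rightarrow> 'a) \<Rightarrow> 'a \<Rightarrow> real) \<Rightarrow> bool" where
  "residual_g_function X D g \<longleftrightarrow>
     residual_in (subtopology (seqtop {..0}) (blocks X {..0})) D \<and>
     continuous_map
       (prod_topology (subtopology (seqtop {..0}) D) (discrete_topology UNIV))
       (top_of_set {0..1}) (\<lambda>(x, \<sigma>). g x \<sigma>) \<and>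
     (\<forall>x\<in>D. (\<Sum>\<sigma> | [\<sigma>] \<in> Gamma_plus X 0 1 x. g x \<sigma>) = 1 \<and>
             (\<forall>\<sigma>. [\<sigma>] \<notin> Gamma_plus X 0 1 x \<longrightarrow> g x \<sigma> = 0)) \<and>
     \<not> (\<exists>z\<in>blocks X {..0} - D. \<exists>h.
          continuous_map (subtopology (seqtop {..0}) (insert z D)) (powertop_real UNIV) h \<and>
          (\<forall>x\<in>D. h x = g x)) \<and>
     blocks X {..1} =
       seqtop {..1} closure_of
         {app 0 x [\<alpha>] | x \<alpha>. x \<in> D \<and> [\<alpha>] \<in> Gamma_plus X 0 1 x \<and> g x \<alpha> > 0}"

text \<open>\<open>g_at g i x\<close> is \<open>g\<close> evaluated, by translation, at a left ray \<open>x\<close> over \<open>{..i}\<close>.\<close>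

definition g_at :: "((int \<Rightarrow> 'a) \<Rightarrow> 'a \<Rightarrow> real) \<Rightarrow> int \<Rightarrow> (int \<Rightarrow> 'a) \<Rightarrow> 'a \<Rightarrow> real" where
  "g_at g i x \<alpha> = g (shift i x) \<alpha>"

definition E_set ::
  "(int \<Rightarrow> 'a) set \<Rightarrow> (int \<Rightarrow> 'a) set \<Rightarrow> ((int \<Rightarrow> 'a) \<Rightarrow> 'a \<Rightarrow> real) \<Rightarrow> (int \<Rightarrow> 'a) set" where
  "E_set X D g =
     {x \<in> X. \<forall>i.
        restrict x {..i} \<in> shift (- i) ` D \<and>
        g_at g i (restrict x {..i}) (x (i + 1)) > 0 \<and>
        (\<forall>k. \<forall>a\<in>Gamma_plus X i k (restrict x {..i}).
           app i (restrict x {..i}) a \<in> shift (- i - int k) ` D)}"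

definition borel_on :: "'c topology \<Rightarrow> 'c measure" where
  "borel_on T = sigma (topspace T) {U. openin T U}"

definition fiber :: "(int \<Rightarrow> 'a) set \<Rightarrow> int \<Rightarrow> (int \<Rightarrow> 'a) \<Rightarrow> (int \<Rightarrow> 'a) set" where
  "fiber X i xm = {y \<in> X. restrict y {..i} = xm}"

definition is_mu ::
  "(int \<Rightarrow> 'a) set \<Rightarrow> ((int \<Rightarrow> 'a) \<Rightarrow> 'a \<Rightarrow> real) \<Rightarrow> int \<Rightarrow> (int \<Rightarrow> 'a) \<Rightarrow> (int \<Rightarrow> 'a) measure \<Rightarrow> bool"
  where
  "is_mu X g i xm M \<longleftrightarrow>
     prob_space M \<and>
     space M = fiber X i xm \<and>
     sets M = sets (borel_on (subtopology (seqtop UNIV) (fiber X i xm))) \<and>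
     (\<forall>N. \<forall>a\<in>Gamma_plus X i N xm.
        measure M {y \<in> fiber X i xm. word i N y = a} =
        (\<Prod>k<N. g_at g (i + int k) (app i xm (take k a)) (a ! k)))"

definition mu ::
  "(int \<Rightarrow> 'a) set \<Rightarrow> ((int \<Rightarrow> 'a) \<Rightarrow> 'a \<Rightarrow> real) \<Rightarrow> int \<Rightarrow> (int \<Rightarrow> 'a) \<Rightarrow> (int \<Rightarrow> 'a) measure" where
  "mu X g i xm = (THE M. is_mu X g i xm M)"

definition leaf :: "(int \<Rightarrow> 'a) set \<Rightarrow> (int \<Rightarrow> 'a) \<Rightarrow> (int \<Rightarrow> 'a) set" where
  "leaf X x = (\<Union>k::nat. fiber X (- int k) (restrict x {..- int k}))"

text \<open>
  \<open>is_lambda X g x L\<close>: \<open>L\<close> is a version of the measure \<open>\<lambda>\<^sub>x\<close>, which is determined only up to a positive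
  constant.  The subspace topology on the leaf and the inductive limit topology of the fibres have
  the same Borel sets, since the fibres are closed and countably many of them cover the leaf.
\<close>

definition is_lambda ::
  "(int \<Rightarrow> 'a) set \<Rightarrow> ((int \<Rightarrow> 'a) \<Rightarrow> 'a \<Rightarrow> real) \<Rightarrow> (int \<Rightarrow> 'a) \<Rightarrow> (int \<Rightarrow> 'a) measure \<Rightarrow> bool" where
  "is_lambda X g x L \<longleftrightarrow>
     sigma_finite_measure L \<and>
     space L = leaf X x \<and>
     sets L = sets (borel_on (subtopology (seqtop UNIV) (leaf X x))) \<and>
     (\<forall>i. let F = fiber X i (restrict x {..i}) in
        0 < emeasure L F \<and> emeasure L F < \<infinity> \<and>
        is_mu X g i (restrict x {..i}) (scale_measure (1 / emeasure L F) (restrict_space L F)))"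

definition is_image ::
  "(int \<Rightarrow> 'a::finite) set \<Rightarrow> (int \<Rightarrow> 'a) set \<Rightarrow> ((int \<Rightarrow> 'a) \<Rightarrow> 'a \<Rightarrow> real) \<Rightarrow>
   (int \<Rightarrow> 'b::finite) set \<Rightarrow> (int \<Rightarrow> 'b) set \<Rightarrow> ((int \<Rightarrow> 'b) \<Rightarrow> 'b \<Rightarrow> real) \<Rightarrow>
   ((int \<Rightarrow> 'a) \<Rightarrow> (int \<Rightarrow> 'b)) \<Rightarrow> bool" where
  "is_image X D g Y D' g' \<phi> \<longleftrightarrow>
     \<phi> ` E_set X D g = E_set Y D' g' \<and>
     (\<forall>x\<in>E_set X D g. \<exists>L L'.
        is_lambda X g x L \<and> is_lambda Y g' (\<phi> x) L' \<and>
        (\<exists>c::real. c > 0 \<and> distr L' L (inv_into X \<phi>) = scale_measure (ennreal c) L))"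

text \<open>
  The measures on the various fibres become comparable as measures on the sequences over
  \<open>{1..}\<close>.
\<close>

definition mu_range ::
  "(int \<Rightarrow> 'a) set \<Rightarrow> (int \<Rightarrow> 'a) set \<Rightarrow> ((int \<Rightarrow> 'a) \<Rightarrow> 'a \<Rightarrow> real) \<Rightarrow> (int \<Rightarrow> 'a) measure set" where
  "mu_range X D g =
     (\<lambda>x. distr (mu X g 0 (restrict x {..0})) (borel_on (seqtop {1..})) (\<lambda>y. restrict y {1..}))
       ` E_set X D g"

end

theory Submission
  imports Defs
begin

text \<open>
  Let \<open>\<phi>\<close> and its inverse be block codes of window \<open>m\<close>.  The preimage under \<open>\<phi>\<close> of the fibre of \<open>\<phi> x\<close> over
  \<open>{..0}\<close> lies in the fibre of \<open>x\<close> over \<open>{..- m}\<close>, and it is cut out there by conditions on the coordinates in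
  \<open>{- m<..m}\<close> that depend only on the two words \<open>u\<close>, \<open>v\<close> of \<open>x\<close> and \<open>\<phi> x\<close> over \<open>{- 3m<..- m}\<close> and
  \<open>{- 2m<..0}\<close>.  Since \<open>\<phi>\<close> carries \<open>\<lambda>\<^sub>x\<close> to a multiple of \<open>\<lambda>\<close> of \<open>\<phi> x\<close>, the measure \<open>\<mu>\<^sub>0\<close> at \<open>\<phi> x\<close> is the image
  under the block code of \<open>\<mu>\<close> at \<open>x\<close> over \<open>{..- m}\<close>, conditioned on this set.  So \<open>\<mu>\<^sub>0\<close> at \<open>\<phi> x\<close> is a
  function of \<open>u\<close>, \<open>v\<close> and of \<open>\<mu>\<^sub>0\<close> at the point \<open>x\<close> translated by \<open>m\<close>, and there are only finitely many
  pairs \<open>(u, v)\<close>.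
\<close>

section \<open>Words, restrictions and powers of the shift\<close>

lemma length_word [simp]: "length (word i n x) = n"
  by (simp add: word_def)

lemma nth_word [simp]: "k < n \<Longrightarrow> word i n x ! k = x (i + 1 + int k)"
  by (simp add: word_def)

lemma word_eq_list_iff:
  "word i (length a) x = a \<longleftrightarrow> (\<forall>j\<in>{i<..i + int (length a)}. x j = a ! nat (j - i - 1))"
proof
  assume w: "word i (length a) x = a"
  show "\<forall>j\<in>{i<..i + int (length a)}. x j = a ! nat (j - i - 1)"
  proof
    fix j assume j: "j \<in> {i<..i + int (length a)}"
    then have "word i (length a) x ! nat (j - i - 1) = x j"
      by (subst nth_word) auto
    then show "x j = a ! nat (j - i - 1)" using w by simp
  qed
next
  assume *: "\<forall>j\<in>{i<..i + int (length a)}. x j = a ! nat (j - i - 1)"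
  show "word i (length a) x = a"
    by (rule nth_equalityI) (use * in auto)
qed

lemma word_eq_iff: "word i n x = word i n y \<longleftrightarrow> (\<forall>j\<in>{i<..i + int n}. x j = y j)"
  using word_eq_list_iff[of i "word i n y" x] word_eq_list_iff[of i "word i n y" y] by auto

lemma word_append: "word i (m + n) x = word i m x @ word (i + int m) n x"
  by (rule nth_equalityI) (auto simp: nth_append algebra_simps)

lemma restrict_eq_iff: "restrict x J = restrict y J \<longleftrightarrow> (\<forall>j\<in>J. x j = y j)"
  by (metis restrict_apply' restrict_ext)

lemma shift_shift [simp]: "shift k (shift l x) = shift (k + l) x"
  by (simp add: shift_def algebra_simps)

lemma shift_0 [simp]: "shift 0 x = x"
  by (simp add: shift_def)

lemma subshift_shift:
  assumes "subshift X" "x \<in> X"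
  shows "shift k x \<in> X"
proof -
  have X: "shift 1 ` X = X" using assms by (simp add: subshift_def)
  have up: "shift 1 z \<in> X" if "z \<in> X" for z using that X by blast
  have down: "shift (-1) z \<in> X" if z: "z \<in> X" for z
  proof -
    obtain w where "w \<in> X" "z = shift 1 w" using z X by blast
    then show ?thesis by simp
  qed
  show ?thesis
  proof (induction k rule: int_induct[where k = 0])
    case base then show ?case using assms by simp
  next
    case (step1 i) then show ?case using up[of "shift i x"] by (simp add: add.commute)
  next
    case (step2 i) then show ?case using down[of "shift i x"] by (simp add: add.commute)
  qed
qed

lemma shift_commute:
  assumes X: "subshift X" and c: "\<And>x. x \<in> X \<Longrightarrow> \<phi> (shift 1 x) = shift 1 (\<phi> x)" and x: "x \<in> X"
  shows "\<phi> (shift k x) = shift k (\<phi> x)"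
proof (induction k rule: int_induct[where k = 0])
  case base then show ?case by simp
next
  case (step1 i)
  then show ?case using c[OF subshift_shift[OF X x, of i]] by (simp add: add.commute)
next
  case (step2 i)
  \<comment> \<open>Commutation is given only for one step upwards, so it is applied at
    \<open>shift (i - 1) x\<close> and one shift is then cancelled.\<close>
  have "shift 1 (\<phi> (shift (i - 1) x)) = shift i (\<phi> x)"
    using c[OF subshift_shift[OF X x, of "i - 1"]] step2 by simp
  then have "shift (-1) (shift 1 (\<phi> (shift (i - 1) x))) = shift (-1) (shift i (\<phi> x))" by simp
  then show ?case by simp
qed

section \<open>The product topology on sequences and sliding block codes\<close>

lemma topspace_seqtop [simp]: "topspace (seqtop J) = extensional J"
  by (auto simp: seqtop_def PiE_def)

lemma openin_agree:
  assumes "finite K" "K \<subseteq> J" "F \<subseteq> extensional J"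
  shows "openin (subtopology (seqtop J) F) {y \<in> F. \<forall>j\<in>K. y j = c j}"
proof -
  let ?S = "\<lambda>j. if j \<in> K then {c j} else UNIV"
  have "{j \<in> J. ?S j \<noteq> UNIV} \<subseteq> K" by auto
  then have "finite {j \<in> J. ?S j \<noteq> UNIV}" using assms(1) by (rule finite_subset)
  then have "openin (seqtop J) (Pi\<^sub>E J ?S)"
    unfolding seqtop_def openin_PiE_gen by (intro disjI2) simp
  moreover have "{y \<in> F. \<forall>j\<in>K. y j = c j} = F \<inter> Pi\<^sub>E J ?S"
  proof -
    have "y \<in> Pi\<^sub>E J ?S \<longleftrightarrow> (\<forall>j\<in>K. y j = c j)" if "y \<in> F" for y
    proof -
      have "y \<in> extensional J" using that assms(3) by blast
      moreover have "(\<forall>j\<in>J. y j \<in> ?S j) \<longleftrightarrow> (\<forall>j\<in>K. y j = c j)"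
        using assms(2) by (metis UNIV_I singletonD singletonI subsetD)
      ultimately show ?thesis by (simp add: PiE_iff)
    qed
    then show ?thesis by blast
  qed
  ultimately show ?thesis by (metis openin_subtopology_Int2)
qed

lemma openin_seqtopE:
  assumes "openin (subtopology (seqtop J) F) U" "y \<in> U"
  obtains K where "finite K" "K \<subseteq> J" "{z \<in> F. \<forall>j\<in>K. z j = y j} \<inter> extensional J \<subseteq> U"
proof -
  obtain V where V: "openin (seqtop J) V" and U: "U = V \<inter> F"
    using assms(1) by (auto simp: openin_subtopology)
  have "y \<in> V" using U assms(2) by simp
  then obtain S where S: "finite {j \<in> J. S j \<noteq> UNIV}" "y \<in> Pi\<^sub>E J S" "Pi\<^sub>E J S \<subseteq> V"
    using V unfolding seqtop_def openin_product_topology_alt by auto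
  \<comment> \<open>\<open>K\<close> consists of the coordinates that the basic box constrains; the
    product topology allows only finitely many.\<close>
  show thesis
  proof
    show "finite {j \<in> J. S j \<noteq> UNIV}" by fact
    show "{z \<in> F. \<forall>j\<in>{j \<in> J. S j \<noteq> UNIV}. z j = y j} \<inter> extensional J \<subseteq> U"
    proof
      fix z assume z: "z \<in> {z \<in> F. \<forall>j\<in>{j \<in> J. S j \<noteq> UNIV}. z j = y j} \<inter> extensional J"
      have "z \<in> Pi\<^sub>E J S"
      proof (rule PiE_I)
        fix j assume "j \<in> J" then show "z j \<in> S j"
          using z S(2) by (cases "S j = UNIV") (auto simp: PiE_def Pi_def)
      next
        fix j assume "j \<notin> J" then show "z j = undefined" using z by (auto simp: extensional_def)
      qed
      then show "z \<in> U" using S(3) U z by auto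
    qed
  qed auto
qed

lemma continuous_map_coordinate:
  "j \<in> J \<Longrightarrow> continuous_map (seqtop J) (discrete_topology UNIV) (\<lambda>y. y j)"
  unfolding seqtop_def by (rule continuous_map_product_projection)

text \<open>Tychonoff's theorem for a finite alphabet; a closed subspace inherits
  compactness.\<close>

lemma compact_space_subshift:
  assumes "subshift (X :: (int \<Rightarrow> 'a::finite) set)"
  shows "compact_space (subtopology (seqtop UNIV) X)"
proof -
  have "compact_space (seqtop UNIV :: (int \<Rightarrow> 'a) topology)"
    unfolding seqtop_def compact_space_product_topology
    by (auto simp: compact_space_discrete_topology)
  then show ?thesis
    using assms closedin_compact_space compact_space_subtopology by (auto simp: subshift_def)
qed

text \<open>Locality is phrased as dependence on a window, not through a local rule on words. This
  avoids choosing such a rule and its values at words that do not occur in \<open>X\<close>.\<close>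

definition block_code :: "(int \<Rightarrow> 'a) set \<Rightarrow> nat \<Rightarrow> ((int \<Rightarrow> 'a) \<Rightarrow> (int \<Rightarrow> 'b)) \<Rightarrow> bool" where
  "block_code X m \<phi> \<longleftrightarrow>
     (\<forall>z\<in>X. \<forall>z'\<in>X. \<forall>j. (\<forall>l\<in>{j - int m..j + int m}. z l = z' l) \<longrightarrow> \<phi> z j = \<phi> z' j)"

lemma block_codeD:
  assumes "block_code X m \<phi>" "z \<in> X" "z' \<in> X" "\<And>l. l \<in> {j - int m..j + int m} \<Longrightarrow> z l = z' l"
  shows "\<phi> z j = \<phi> z' j"
proof -
  have "\<forall>l\<in>{j - int m..j + int m}. z l = z' l" using assms(4) by simp
  then show ?thesis using assms(1-3) unfolding block_code_def by (metis (no_types))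
qed

lemma block_code_mono:
  assumes "block_code X m \<phi>" "m \<le> n"
  shows "block_code X n \<phi>"
  unfolding block_code_def
proof (intro ballI allI impI)
  fix z z' j assume "z \<in> X" "z' \<in> X" "\<forall>l\<in>{j - int n..j + int n}. z l = z' l"
  then show "\<phi> z j = \<phi> z' j" using assms(2) by (intro block_codeD[OF assms(1)]) auto
qed

text \<open>The Curtis--Hedlund--Lyndon theorem.\<close>

lemma sliding_block_code:
  fixes X :: "(int \<Rightarrow> 'a::finite) set" and Y :: "(int \<Rightarrow> 'b) set"
  assumes X: "subshift X"
    and cont: "continuous_map (subtopology (seqtop UNIV) X) (subtopology (seqtop UNIV) Y) \<phi>"
    and c: "\<And>x. x \<in> X \<Longrightarrow> \<phi> (shift 1 x) = shift 1 (\<phi> x)"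
  obtains m where "block_code X m \<phi>"
proof -
  let ?T = "subtopology (seqtop UNIV) X"
  have ts: "topspace ?T = X" by simp
  \<comment> \<open>Continuity and compactness are used at coordinate 0 only; commutation with the
    shift carries the result to every coordinate at the end.\<close>
  have "continuous_map ?T (discrete_topology UNIV) (\<lambda>z. \<phi> z 0)"
    using continuous_map_compose[OF continuous_map_into_fulltopology[OF cont]
        continuous_map_coordinate[of 0 UNIV]] by (simp add: o_def)
  then have op: "openin ?T {z' \<in> X. \<phi> z' 0 \<in> {\<phi> z 0}}" for z
    using openin_continuous_map_preimage[of ?T "discrete_topology UNIV" "\<lambda>z. \<phi> z 0" "{\<phi> z 0}"] ts
    by simp
  have "\<exists>K. finite K \<and> {z' \<in> X. \<forall>j\<in>K. z' j = z j} \<subseteq> {z' \<in> X. \<phi> z' 0 \<in> {\<phi> z 0}}"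
    if z: "z \<in> X" for z
  proof -
    have "z \<in> {z' \<in> X. \<phi> z' 0 \<in> {\<phi> z 0}}" using z by simp
    then obtain K where "finite K"
      "{z' \<in> X. \<forall>j\<in>K. z' j = z j} \<inter> extensional UNIV \<subseteq> {z' \<in> X. \<phi> z' 0 \<in> {\<phi> z 0}}"
      by (rule openin_seqtopE[OF op])
    then show ?thesis by (intro exI[of _ K]) simp
  qed
  then have "\<forall>z\<in>X. \<exists>K. finite K \<and>
      {z' \<in> X. \<forall>j\<in>K. z' j = z j} \<subseteq> {z' \<in> X. \<phi> z' 0 \<in> {\<phi> z 0}}" by simp
  from bchoice[OF this] obtain K where K: "\<And>z. z \<in> X \<Longrightarrow> finite (K z)"
    "\<And>z. z \<in> X \<Longrightarrow> {z' \<in> X. \<forall>j\<in>K z. z' j = z j} \<subseteq> {z' \<in> X. \<phi> z' 0 \<in> {\<phi> z 0}}"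
    by blast
  let ?B = "\<lambda>z. {z' \<in> X. \<forall>j\<in>K z. z' j = z j}"
  \<comment> \<open>Compactness: finitely many of the open sets \<open>?B z\<close>, on each of
    which the symbol at 0 of the image is constant, cover \<open>X\<close>.\<close>
  have "\<exists>\<F>. finite \<F> \<and> \<F> \<subseteq> ?B ` X \<and> X \<subseteq> \<Union>\<F>"
  proof -
    have "\<forall>U\<in>?B ` X. openin ?T U" by (auto intro!: openin_agree K(1))
    moreover have "X \<subseteq> \<Union>(?B ` X)" by blast
    ultimately show ?thesis
      using compact_space_subshift[OF X] unfolding compact_space_alt ts by meson
  qed
  then obtain Z where Z: "finite Z" "Z \<subseteq> X" "X \<subseteq> (\<Union>z\<in>Z. ?B z)"
    by (metis (no_types, lifting) finite_subset_image)
  have fin: "finite (\<Union>z\<in>Z. K z)" using Z K by auto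
  \<comment> \<open>The window radius bounds all coordinates inspected by the finite cover. Points
    that agree on the window therefore lie in the same members of the cover.\<close>
  obtain m where m: "\<And>l. l \<in> (\<Union>z\<in>Z. K z) \<Longrightarrow> nat \<bar>l\<bar> \<le> m"
    using finite_imageI[OF fin, of "\<lambda>l. nat \<bar>l\<bar>"] unfolding finite_nat_set_iff_bounded_le by blast
  have zero: "\<phi> z 0 = \<phi> z' 0"
    if z: "z \<in> X" "z' \<in> X" and eq: "\<And>l. l \<in> {- int m..int m} \<Longrightarrow> z l = z' l" for z z'
  proof -
    obtain w where w: "w \<in> Z" "z \<in> ?B w" using Z z by blast
    have "z l = z' l" if "l \<in> K w" for l
    proof -
      have "nat \<bar>l\<bar> \<le> m" using m that w by blast
      then show ?thesis using eq[of l] by force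
    qed
    then have "z' \<in> ?B w" using w z by auto
    moreover have "{z' \<in> X. \<forall>j\<in>K w. z' j = w j} \<subseteq> {z' \<in> X. \<phi> z' 0 \<in> {\<phi> w 0}}"
      using w(1) Z(2) by (intro K(2)) blast
    ultimately have "z \<in> {z' \<in> X. \<phi> z' 0 \<in> {\<phi> w 0}}" "z' \<in> {z' \<in> X. \<phi> z' 0 \<in> {\<phi> w 0}}"
      using w(2) by blast+
    then show ?thesis by simp
  qed
  have "block_code X m \<phi>"
    unfolding block_code_def
  proof (intro ballI allI impI)
    fix z z' j
    assume z: "z \<in> X" "z' \<in> X" and eq: "\<forall>l\<in>{j - int m..j + int m}. z l = z' l"
    have "\<phi> (shift j z) 0 = \<phi> (shift j z') 0"
    proof (rule zero)
      fix l assume "l \<in> {- int m..int m}"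
      then have "l + j \<in> {j - int m..j + int m}" by auto
      then show "shift j z l = shift j z' l" using eq by (simp add: shift_def)
    qed (use z X subshift_shift in auto)
    then show "\<phi> z j = \<phi> z' j"
      using shift_commute[where \<phi> = \<phi>, OF X c] z by (simp add: shift_def)
  qed
  then show thesis by (rule that)
qed

section \<open>Borel sets of sequence spaces and cylinders\<close>

lemma space_borel_on [simp]: "space (borel_on T) = topspace T"
  by (auto simp: borel_on_def space_measure_of_conv)

lemma sets_borel_on: "sets (borel_on T) = sigma_sets (topspace T) {U. openin T U}"
  by (auto simp: borel_on_def intro!: sets_measure_of dest: openin_subset)

lemma openin_borel_on: "openin T U \<Longrightarrow> U \<in> sets (borel_on T)"
  by (simp add: sets_borel_on sigma_sets.Basic)

lemma measurable_borel_on: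
  assumes "continuous_map T T' f"
  shows "f \<in> borel_on T \<rightarrow>\<^sub>M borel_on T'"
  unfolding borel_on_def[of T']
proof (rule measurable_measure_of)
  show "{U. openin T' U} \<subseteq> Pow (topspace T')" by (auto dest: openin_subset)
  show "f \<in> space (borel_on T) \<rightarrow> topspace T'"
    using assms by (auto simp: continuous_map_def)
  fix U assume "U \<in> {U. openin T' U}"
  then have "openin T {x \<in> topspace T. f x \<in> U}"
    using assms by (auto intro: openin_continuous_map_preimage)
  moreover have "f -` U \<inter> space (borel_on T) = {x \<in> topspace T. f x \<in> U}" by auto
  ultimately show "f -` U \<inter> space (borel_on T) \<in> sets (borel_on T)"
    using openin_borel_on by metis
qed

text \<open>The ambient set is a parameter because cylinders are taken in fibres, in leaves and in
  the space of sequences over \<open>{1..}\<close>.\<close>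

definition cylinder :: "(int \<Rightarrow> 'a) set \<Rightarrow> int \<Rightarrow> 'a list \<Rightarrow> (int \<Rightarrow> 'a) set" where
  "cylinder F i a = {y \<in> F. word i (length a) y = a}"

lemma cylinder_Nil [simp]: "cylinder F i [] = F"
  by (simp add: cylinder_def word_def)

lemma openin_cylinder:
  assumes "{i<..} \<subseteq> J" "F \<subseteq> extensional J"
  shows "openin (subtopology (seqtop J) F) (cylinder F i a)"
  unfolding cylinder_def word_eq_list_iff
  using assms by (intro openin_agree) auto

text \<open>Both words start at the same place, so the shorter one either is a prefix of the longer
  one or contradicts it. Together with the empty set the cylinders thus form a pi-system.\<close>

lemma cylinder_Int:
  assumes "length a \<le> length b"
  shows "cylinder F i a \<inter> cylinder F i b \<in> {{}, cylinder F i b}"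
proof (cases "take (length a) b = a")
  case True
  have "word i (length a) y = a" if "word i (length b) y = b" for y
  proof -
    have "word i (length a) y = take (length a) (word i (length b) y)"
      using assms by (auto simp: word_def take_map)
    then show ?thesis using that True by simp
  qed
  then show ?thesis by (auto simp: cylinder_def)
next
  case False
  have "word i (length a) y \<noteq> a" if "word i (length b) y = b" for y
  proof -
    have "word i (length a) y = take (length a) (word i (length b) y)"
      using assms by (auto simp: word_def take_map)
    then show ?thesis using that False by simp
  qed
  then show ?thesis by (auto simp: cylinder_def)
qed

text \<open>Points of \<open>F\<close> agree at all coordinates up to \<open>i\<close>, so on
  \<open>F\<close> finitely many coordinate conditions follow from fixing one word that starts at
  \<open>i + 1\<close>. The assumption \<open>past\<close> covers fibres, and it is vacuous for
  sequences over \<open>{1..}\<close> with \<open>i = 0\<close>.\<close>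

lemma sets_borel_on_cylinders:
  fixes F :: "(int \<Rightarrow> 'a::finite) set"
  assumes J: "{i<..} \<subseteq> J" and F: "F \<subseteq> extensional J"
    and past: "\<forall>y\<in>F. \<forall>z\<in>F. \<forall>j\<in>J. j \<le> i \<longrightarrow> y j = z j"
  shows "sets (borel_on (subtopology (seqtop J) F)) = sigma_sets F (insert {} (range (cylinder F i)))"
proof -
  let ?T = "subtopology (seqtop J) F"
  have ts: "topspace ?T = F" using F by auto
  have "U \<in> sigma_sets F (insert {} (range (cylinder F i)))" if U: "openin ?T U" for U
  proof -
    have "\<exists>a. y \<in> cylinder F i a \<and> cylinder F i a \<subseteq> U" if y: "y \<in> U" for y
    proof -
      obtain K where K: "finite K" "K \<subseteq> J" "{z \<in> F. \<forall>j\<in>K. z j = y j} \<inter> extensional J \<subseteq> U"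
        using openin_seqtopE[OF U y] .
      have yF: "y \<in> F" using openin_subset[OF U] y ts by blast
      obtain n where n: "\<And>j. j \<in> K \<Longrightarrow> nat (j - i) \<le> n"
        using finite_imageI[OF K(1), of "\<lambda>j. nat (j - i)"] finite_nat_set_iff_bounded_le by auto
      have "z \<in> U" if z: "z \<in> F" "word i n z = word i n y" for z
      proof -
        have "z j = y j" if j: "j \<in> K" for j
        proof (cases "j \<le> i")
          case True then show ?thesis using past yF z j K by blast
        next
          case False then show ?thesis using z(2) n[OF j] by (auto simp: word_eq_iff)
        qed
        then show ?thesis using K(3) z F by blast
      qed
      then show ?thesis using yF by (intro exI[of _ "word i n y"]) (auto simp: cylinder_def)
    qed
    \<comment> \<open>This union is countable, since there are only countably many words over a
      finite alphabet.\<close>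
    then have eq: "U = \<Union> (cylinder F i ` {a. cylinder F i a \<subseteq> U})" by blast
    show ?thesis
      by (subst eq, rule sigma_sets_UNION) (auto intro: sigma_sets.Basic)
  qed
  moreover have "C \<in> sigma_sets F {U. openin ?T U}" if "C \<in> insert {} (range (cylinder F i))" for C
    using that openin_cylinder[OF J F] by (auto intro: sigma_sets.Basic sigma_sets.Empty)
  ultimately show ?thesis
    unfolding sets_borel_on ts by (intro sigma_sets_eqI) auto
qed

text \<open>Uniqueness of finite measures on a generating pi-system. The cylinder of the empty word
  is \<open>F\<close> itself, so a constant sequence exhausts the space.\<close>

lemma measure_eqI_cylinders:
  fixes F :: "(int \<Rightarrow> 'a::finite) set"
  assumes J: "{i<..} \<subseteq> J" and F: "F \<subseteq> extensional J"
    and past: "\<forall>y\<in>F. \<forall>z\<in>F. \<forall>j\<in>J. j \<le> i \<longrightarrow> y j = z j"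
    and M: "finite_measure M" "sets M = sets (borel_on (subtopology (seqtop J) F))"
    and N: "finite_measure N" "sets N = sets (borel_on (subtopology (seqtop J) F))"
    and eq: "\<And>a. measure M (cylinder F i a) = measure N (cylinder F i a)"
  shows "M = N"
proof -
  interpret M: finite_measure M by fact
  interpret N: finite_measure N by fact
  let ?G = "insert {} (range (cylinder F i))"
  note gen = sets_borel_on_cylinders[OF J F past]
  show ?thesis
  proof (rule measure_eqI_generator_eq[where E = ?G and \<Omega> = F and A = "\<lambda>_. cylinder F i []"])
    show "Int_stable ?G"
    proof (rule Int_stableI)
      fix A B assume AB: "A \<in> ?G" "B \<in> ?G"
      have "cylinder F i a \<inter> cylinder F i b \<in> ?G" for a b
        using cylinder_Int[of a b F i] cylinder_Int[of b a F i] linear[of "length a" "length b"]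
        by (metis (no_types, lifting) Int_commute insert_iff rangeI singletonD)
      then show "A \<inter> B \<in> ?G" using AB by auto
    qed
    show "?G \<subseteq> Pow F" by (auto simp: cylinder_def)
    show "emeasure M C = emeasure N C" if "C \<in> ?G" for C
      using that eq by (auto simp: M.emeasure_eq_measure N.emeasure_eq_measure)
    show "sets M = sigma_sets F ?G" "sets N = sigma_sets F ?G" using M N gen by auto
    show "range (\<lambda>_. cylinder F i []) \<subseteq> ?G" by blast
    show "(\<Union>n::nat. cylinder F i []) = F" by simp
    show "emeasure M (cylinder F i []) \<noteq> \<infinity>" for n :: nat by simp
  qed
qed

section \<open>Translation invariance of continuations, word probabilities and
  \<open>E_set\<close>\<close>

lemma shift_restrict: "shift k (restrict x {..i}) = restrict (shift k x) {..i - k}"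
  by (auto simp: shift_def restrict_def fun_eq_iff)

lemma shift_app: "shift k (app i x a) = app (i - k) (shift k x) a"
  by (auto simp: shift_def app_def restrict_def fun_eq_iff algebra_simps)

lemma shift_blocks:
  assumes "subshift X"
  shows "shift k ` blocks X {..i} = blocks X {..i - k}"
proof -
  have "shift k ` X = X"
  proof
    show "X \<subseteq> shift k ` X"
    proof
      fix x assume "x \<in> X"
      then have "shift (- k) x \<in> X" "x = shift k (shift (- k) x)"
        using assms subshift_shift by auto
      then show "x \<in> shift k ` X" by blast
    qed
  qed (use assms subshift_shift in blast)
  moreover have "shift k ` blocks X {..i} = (\<lambda>x. restrict x {..i - k}) ` shift k ` X"
    unfolding blocks_def image_image shift_restrict ..
  ultimately show ?thesis by (simp add: blocks_def)
qed

lemma Gamma_plus_shift: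
  assumes X: "subshift X"
  shows "Gamma_plus X (i - k) n (shift k x) = Gamma_plus X i n x"
proof -
  have "shift k (app i x b) \<in> blocks X {..i - k + int n} \<longleftrightarrow> app i x b \<in> blocks X {..i + int n}" for b
  proof -
    have "inj (shift k)" by (rule inj_on_inverseI[where g = "shift (- k)"]) simp
    then show ?thesis
      using shift_blocks[OF X, of k "i + int n"] inj_image_mem_iff
      by (metis add_diff_eq diff_add_eq)
  qed
  then show ?thesis by (simp add: Gamma_plus_def shift_app)
qed

lemma mem_Gamma_plus_iff:
  "a \<in> Gamma_plus X i n (restrict x {..i}) \<longleftrightarrow>
    length a = n \<and> (\<exists>y\<in>X. restrict y {..i} = restrict x {..i} \<and> word i (length a) y = a)"
proof -
  have "app i (restrict x {..i}) a = restrict y {..i + int (length a)} \<longleftrightarrow>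
      restrict y {..i} = restrict x {..i} \<and> word i (length a) y = a" for y
    unfolding app_def restrict_eq_iff word_eq_list_iff
    by (auto simp: all_conj_distrib split: if_splits)
  then show ?thesis by (auto simp: Gamma_plus_def blocks_def)
qed

text \<open>The default 0 outside \<open>Gamma_plus\<close> makes this a total function of the word,
  so that laws over different pasts can be compared as functions. These functions replace the
  measures in the counting.\<close>

definition word_prob ::
  "(int \<Rightarrow> 'a) set \<Rightarrow> ((int \<Rightarrow> 'a) \<Rightarrow> 'a \<Rightarrow> real) \<Rightarrow> int \<Rightarrow> (int \<Rightarrow> 'a) \<Rightarrow> 'a list \<Rightarrow> real" where
  "word_prob X g i x a =
     (if a \<in> Gamma_plus X i (length a) (restrict x {..i})
      then \<Prod>k<length a. g_at g (i + int k) (app i (restrict x {..i}) (take k a)) (a ! k) else 0)"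

text \<open>\<open>g_at\<close> moves every ray back to \<open>{..0}\<close> before evaluating
  \<open>g\<close>, so only the position relative to the point matters. A law over
  \<open>{..- int m}\<close> can thereby be read as a law over \<open>{..0}\<close> at a translated
  point.\<close>

lemma word_prob_shift:
  assumes X: "subshift X"
  shows "word_prob X g i (shift k x) = word_prob X g (i + k) x"
proof
  fix a
  have r: "restrict (shift k x) {..i} = shift k (restrict x {..i + k})"
    by (simp add: shift_restrict)
  have a: "app i (shift k z) w = shift k (app (i + k) z w)" for z w
    by (simp add: shift_app)
  have "g_at g (i + l) (app i (shift k z) w) s = g_at g (i + k + l) (app (i + k) z w) s" for l z w s
    unfolding a by (simp add: g_at_def add_ac)
  then show "word_prob X g i (shift k x) a = word_prob X g (i + k) x a"
    using Gamma_plus_shift[OF X, of "i + k" k] by (simp add: word_prob_def r)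
qed

text \<open>Every defining condition is imposed at all \<open>i\<close>, so the condition at
  \<open>i\<close> for the translated point is the one at \<open>i + m\<close> for
  \<open>x\<close>.\<close>

lemma E_set_shift:
  assumes X: "subshift X" and x: "x \<in> E_set X D g"
  shows "shift m x \<in> E_set X D g"
  unfolding E_set_def
proof (intro CollectI conjI allI ballI)
  show "shift m x \<in> X" using x X subshift_shift by (auto simp: E_set_def)
  fix i
  have r: "restrict (shift m x) {..i} = shift m (restrict x {..i + m})"
    by (simp add: shift_restrict)
  have D: "shift m z \<in> shift (- i - k) ` D" if z: "z \<in> shift (- (i + m) - k) ` D" for z k
  proof -
    obtain d where d: "d \<in> D" "z = shift (- (i + m) - k) d" using z by blast
    then have "shift m z = shift (- i - k) d" by simp
    then show ?thesis using d by blast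
  qed
  show "restrict (shift m x) {..i} \<in> shift (- i) ` D"
    unfolding r using D[of "restrict x {..i + m}" 0] x by (simp add: E_set_def del: minus_add_distrib)
  have "g_at g (i + m) (restrict x {..i + m}) (x (i + m + 1)) > 0"
    using x by (auto simp: E_set_def)
  moreover have "shift m x (i + 1) = x (i + m + 1)" by (simp add: shift_def add_ac)
  ultimately show "g_at g i (restrict (shift m x) {..i}) (shift m x (i + 1)) > 0"
    unfolding r g_at_def by simp
  fix k a assume a: "a \<in> Gamma_plus X i k (restrict (shift m x) {..i})"
  then have "a \<in> Gamma_plus X (i + m) k (restrict x {..i + m})"
    unfolding r using Gamma_plus_shift[OF X, of "i + m" m] by simp
  then have "app (i + m) (restrict x {..i + m}) a \<in> shift (- (i + m) - int k) ` D"
    using x unfolding E_set_def by blast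
  moreover have "app i (shift m (restrict x {..i + m})) a = shift m (app (i + m) (restrict x {..i + m}) a)"
    by (simp add: shift_app)
  ultimately show "app i (restrict (shift m x) {..i}) a \<in> shift (- i - int k) ` D"
    unfolding r using D by simp
qed

section \<open>Fibres, leaves and the probability measures on fibres\<close>

lemma mem_fiber_iff: "z \<in> fiber X i (restrict x {..i}) \<longleftrightarrow> z \<in> X \<and> (\<forall>j\<le>i. z j = x j)"
  by (auto simp: fiber_def restrict_eq_iff)

lemma mem_leaf_iff: "z \<in> leaf X x \<longleftrightarrow> z \<in> X \<and> (\<exists>k::nat. \<forall>j\<le>- int k. z j = x j)"
  by (auto simp: leaf_def mem_fiber_iff)

lemma fiber_subset_leaf: "fiber X i (restrict x {..i}) \<subseteq> leaf X x"
proof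
  fix z assume "z \<in> fiber X i (restrict x {..i})"
  then show "z \<in> leaf X x"
    unfolding mem_fiber_iff mem_leaf_iff by (intro conjI exI[of _ "nat (- i)"]) auto
qed

text \<open>Outside \<open>Gamma_plus\<close>, where \<open>is_mu\<close> prescribes nothing, the
  cylinder is empty, in agreement with the default value of \<open>word_prob\<close>.\<close>

lemma is_mu_cylinder:
  assumes "is_mu X g i (restrict x {..i}) M"
  shows "measure M (cylinder (fiber X i (restrict x {..i})) i a) = word_prob X g i x a"
proof (cases "a \<in> Gamma_plus X i (length a) (restrict x {..i})")
  case True
  then show ?thesis using assms by (auto simp: is_mu_def cylinder_def word_prob_def)
next
  case False
  then have "cylinder (fiber X i (restrict x {..i})) i a = {}"
    by (auto simp: mem_Gamma_plus_iff cylinder_def fiber_def)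
  then show ?thesis using False by (simp add: word_prob_def)
qed

lemma is_mu_unique:
  fixes X :: "(int \<Rightarrow> 'a::finite) set"
  assumes M: "is_mu X g i (restrict x {..i}) M" and N: "is_mu X g i (restrict x {..i}) N"
  shows "M = N"
proof (rule measure_eqI_cylinders[where J = UNIV and i = i and F = "fiber X i (restrict x {..i})"])
  show "\<forall>y\<in>fiber X i (restrict x {..i}). \<forall>z\<in>fiber X i (restrict x {..i}). \<forall>j\<in>UNIV. j \<le> i \<longrightarrow> y j = z j"
    by (simp add: mem_fiber_iff)
  show "finite_measure M" "finite_measure N"
    using M N by (auto simp: is_mu_def prob_space_def)
  show "measure M (cylinder (fiber X i (restrict x {..i})) i a)
      = measure N (cylinder (fiber X i (restrict x {..i})) i a)" for a
    using is_mu_cylinder[OF M] is_mu_cylinder[OF N] by simp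
qed (use M N in \<open>simp_all add: is_mu_def\<close>)

text \<open>Since \<open>mu\<close> is a definite description, it is used only through a witness;
  the witnesses will come from normalised restrictions of the leaf measures.\<close>

lemma mu_eq:
  fixes X :: "(int \<Rightarrow> 'a::finite) set"
  assumes "is_mu X g i (restrict x {..i}) M"
  shows "mu X g i (restrict x {..i}) = M"
  unfolding mu_def using assms is_mu_unique by (intro the_equality)

lemma continuous_map_restrict:
  "continuous_map (seqtop UNIV) (seqtop J) (\<lambda>x. restrict x J)"
  unfolding seqtop_def[of J] continuous_map_componentwise
  by (auto simp: continuous_map_coordinate)

abbreviation future_law :: "(int \<Rightarrow> 'a) measure \<Rightarrow> (int \<Rightarrow> 'a) measure" where
  "future_law M \<equiv> distr M (borel_on (seqtop {1..})) (\<lambda>y. restrict y {1..})"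

text \<open>Cylinders in the fibre are the preimages of cylinders over \<open>{1..}\<close>, so
  \<open>word_prob\<close> gives the values of the future law on a generating pi-system. Counting
  measures thus becomes counting functions on words.\<close>

lemma future_law_eq_iff:
  fixes X :: "(int \<Rightarrow> 'a::finite) set"
  assumes M: "is_mu X g 0 (restrict x {..0}) M" and N: "is_mu X g 0 (restrict z {..0}) N"
  shows "future_law M = future_law N \<longleftrightarrow> word_prob X g 0 x = word_prob X g 0 z"
proof -
  let ?B = "borel_on (seqtop {1..}) :: (int \<Rightarrow> 'a) measure"
  have sub: "subtopology (seqtop {1..}) (extensional {1..}) = (seqtop {1..} :: (int \<Rightarrow> 'a) topology)"
    by (metis subtopology_topspace topspace_seqtop)
  have C: "cylinder (extensional {1..}) 0 a \<in> sets ?B" for a :: "'a list"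
  proof -
    have "{0::int<..} \<subseteq> {1..}" by auto
    then show ?thesis
      using openin_cylinder[of 0 "{1..}" "extensional {1..}" a] unfolding sub
      by (intro openin_borel_on) auto
  qed
  have meas: "(\<lambda>y. restrict y {1..}) \<in> P \<rightarrow>\<^sub>M ?B" if "is_mu X g 0 (restrict w {..0}) P" for P w
  proof -
    have "(\<lambda>y. restrict y {1..}) \<in> borel_on (subtopology (seqtop UNIV) (fiber X 0 (restrict w {..0}))) \<rightarrow>\<^sub>M ?B"
      by (intro measurable_borel_on continuous_map_from_subtopology continuous_map_restrict)
    then show ?thesis
      using that measurable_cong_sets[of P "borel_on (subtopology (seqtop UNIV) (fiber X 0 (restrict w {..0})))" ?B ?B]
      by (simp add: is_mu_def)
  qed
  have cyl: "measure (future_law P) (cylinder (extensional {1..}) 0 a) = word_prob X g 0 w a"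
    if P: "is_mu X g 0 (restrict w {..0}) P" for P w a
  proof -
    have "(\<lambda>y. restrict y {1..}) -` cylinder (extensional {1..}) 0 a \<inter> space P
        = cylinder (fiber X 0 (restrict w {..0})) 0 a"
      using P by (auto simp: cylinder_def is_mu_def word_eq_list_iff)
    then show ?thesis using measure_distr[OF meas[OF P] C] is_mu_cylinder[OF P] by simp
  qed
  have fin: "finite_measure (future_law P)" if P: "is_mu X g 0 (restrict w {..0}) P" for P w
    using P meas[OF P] prob_space.prob_space_distr by (auto simp: is_mu_def prob_space_def)
  show ?thesis
  proof
    assume "future_law M = future_law N"
    then show "word_prob X g 0 x = word_prob X g 0 z"
      using cyl[OF M] cyl[OF N] by (metis ext)
  next
    assume eq: "word_prob X g 0 x = word_prob X g 0 z"
    show "future_law M = future_law N"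
    proof (rule measure_eqI_cylinders[where J = "{1..}" and i = 0 and F = "extensional {1..}"])
      show "finite_measure (future_law M)" "finite_measure (future_law N)"
        using fin M N by auto
      show "sets (future_law M) = sets (borel_on (subtopology (seqtop {1..}) (extensional {1..})))"
        "sets (future_law N) = sets (borel_on (subtopology (seqtop {1..}) (extensional {1..})))"
        by (simp_all add: sub)
      show "measure (future_law M) (cylinder (extensional {1..}) 0 a)
          = measure (future_law N) (cylinder (extensional {1..}) 0 a)" for a
        using cyl[OF M] cyl[OF N] eq by simp
    qed auto
  qed
qed

section \<open>Reduction of fibre and leaf measures to word probabilities\<close>

lemma image_factors:
  assumes "\<And>x y. \<lbrakk>x \<in> E; y \<in> E; r x = r y\<rbrakk> \<Longrightarrow> h x = h y"
  obtains k where "h ` E = k ` r ` E"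
proof -
  \<comment> \<open>As \<open>h\<close> depends only on \<open>r x\<close>, it may be evaluated at a
    chosen representative.\<close>
  have "h ` E = (\<lambda>p. h (SOME x. x \<in> E \<and> r x = p)) ` r ` E"
    unfolding image_image
  proof (rule image_cong)
    fix x assume "x \<in> E"
    then show "h x = h (SOME z. z \<in> E \<and> r z = r x)"
      using assms someI[of "\<lambda>z. z \<in> E \<and> r z = r x" x] by metis
  qed simp
  then show thesis by (rule that)
qed

text \<open>On \<open>E_set\<close> each of the two maps factors through the other, so either image
  is an image of the other one.\<close>

lemma mu_range_card_iff:
  fixes X :: "(int \<Rightarrow> 'a::finite) set"
  assumes "\<And>x. x \<in> E_set X D g \<Longrightarrow> \<exists>M. is_mu X g 0 (restrict x {..0}) M"
  shows "finite (mu_range X D g) \<longleftrightarrow> finite (word_prob X g 0 ` E_set X D g)"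
    and "countable (mu_range X D g) \<longleftrightarrow> countable (word_prob X g 0 ` E_set X D g)"
proof -
  let ?E = "E_set X D g"
  let ?h = "\<lambda>x. future_law (mu X g 0 (restrict x {..0}))"
  have eq: "?h x = ?h y \<longleftrightarrow> word_prob X g 0 x = word_prob X g 0 y" if "x \<in> ?E" "y \<in> ?E" for x y
    using assms[OF that(1)] assms[OF that(2)] future_law_eq_iff mu_eq by metis
  obtain k where k: "?h ` ?E = k ` word_prob X g 0 ` ?E"
    using image_factors[of ?E "word_prob X g 0" ?h] eq by metis
  obtain l where l: "word_prob X g 0 ` ?E = l ` ?h ` ?E"
    using image_factors[of ?E ?h "word_prob X g 0"] eq by metis
  show "finite (mu_range X D g) \<longleftrightarrow> finite (word_prob X g 0 ` E_set X D g)"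
    unfolding mu_range_def using k l by (metis finite_imageI)
  show "countable (mu_range X D g) \<longleftrightarrow> countable (word_prob X g 0 ` E_set X D g)"
    unfolding mu_range_def using k l by (metis countable_image)
qed

lemma is_lambdaD:
  fixes X :: "(int \<Rightarrow> 'a::finite) set"
  assumes L: "is_lambda X g x L"
  defines "F \<equiv> \<lambda>i. fiber X i (restrict x {..i})"
  shows "emeasure L (F i) < \<infinity>" and "measure L (F i) > 0"
    and "cylinder (F i) i a \<in> sets L"
    and "measure L (cylinder (F i) i a) = measure L (F i) * word_prob X g i x a"
    and "is_mu X g i (restrict x {..i}) (scale_measure (1 / emeasure L (F i)) (restrict_space L (F i)))"
proof -
  have *: "0 < emeasure L (F i)" "emeasure L (F i) < \<infinity>"
    and mu: "is_mu X g i (restrict x {..i}) (scale_measure (1 / emeasure L (F i)) (restrict_space L (F i)))"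
    using L unfolding is_lambda_def F_def Let_def by auto
  show "emeasure L (F i) < \<infinity>" by fact
  show "is_mu X g i (restrict x {..i}) (scale_measure (1 / emeasure L (F i)) (restrict_space L (F i)))"
    by fact
  show pos: "measure L (F i) > 0" using * by (simp add: measure_def enn2real_positive_iff)
  \<comment> \<open>\<open>emeasure\<close> vanishes on non-measurable sets, so positivity already
    forces the fibre to be measurable.\<close>
  have F: "F i \<in> sets L" using *(1) emeasure_notin_sets by fastforce
  have "cylinder (leaf X x) i a \<in> sets L"
    using L openin_cylinder[of i UNIV "leaf X x" a] openin_borel_on by (auto simp: is_lambda_def)
  moreover have "cylinder (F i) i a = F i \<inter> cylinder (leaf X x) i a"
    using fiber_subset_leaf[of X i x] by (auto simp: cylinder_def F_def)
  ultimately show C: "cylinder (F i) i a \<in> sets L" using F by simp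
  have e: "emeasure L (F i) = ennreal (measure L (F i))"
    using *(2) by (simp add: emeasure_eq_ennreal_measure)
  have "1 / emeasure L (F i) = ennreal (1 / measure L (F i))"
    unfolding e using divide_ennreal[of 1 "measure L (F i)"] pos by simp
  moreover have "measure (restrict_space L (F i)) (cylinder (F i) i a) = measure L (cylinder (F i) i a)"
    using F sets.sets_into_space[OF F]
    by (intro measure_restrict_space) (auto simp: cylinder_def Int_absorb2)
  ultimately have "word_prob X g i x a = 1 / measure L (F i) * measure L (cylinder (F i) i a)"
    using is_mu_cylinder[OF mu, of a] by (simp add: F_def)
  then show "measure L (cylinder (F i) i a) = measure L (F i) * word_prob X g i x a"
    using pos by simp
qed

section \<open>Transport of word probabilities along a conjugacy\<close>

locale conjugate_pair =
  fixes X :: "(int \<Rightarrow> 'a::finite) set" and Y :: "(int \<Rightarrow> 'b::finite) set"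
    and \<phi> :: "(int \<Rightarrow> 'a) \<Rightarrow> (int \<Rightarrow> 'b)" and \<psi> :: "(int \<Rightarrow> 'b) \<Rightarrow> (int \<Rightarrow> 'a)"
  assumes X: "subshift X" and Y: "subshift Y"
    and hom: "homeomorphic_maps (subtopology (seqtop UNIV) X) (subtopology (seqtop UNIV) Y) \<phi> \<psi>"
    and \<phi>_shift: "x \<in> X \<Longrightarrow> \<phi> (shift 1 x) = shift 1 (\<phi> x)"
    and \<psi>_shift: "y \<in> Y \<Longrightarrow> \<psi> (shift 1 y) = shift 1 (\<psi> y)"
begin

text \<open>The locale is symmetric, so every result on passing from \<open>X\<close> to
  \<open>Y\<close> also yields its converse.\<close>

lemma swap: "conjugate_pair Y X \<psi> \<phi>"
  by (rule conjugate_pair.intro[OF Y X hom[THEN homeomorphic_maps_sym[THEN iffD1]] \<psi>_shift \<phi>_shift])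

lemma maps: "x \<in> X \<Longrightarrow> \<phi> x \<in> Y" "y \<in> Y \<Longrightarrow> \<psi> y \<in> X" "x \<in> X \<Longrightarrow> \<psi> (\<phi> x) = x" "y \<in> Y \<Longrightarrow> \<phi> (\<psi> y) = y"
  using hom by (auto simp: homeomorphic_maps_def continuous_map_def)

lemma common_window:
  obtains m where "block_code X m \<phi>" "block_code Y m \<psi>"
proof -
  have c: "continuous_map (subtopology (seqtop UNIV) X) (subtopology (seqtop UNIV) Y) \<phi>"
    "continuous_map (subtopology (seqtop UNIV) Y) (subtopology (seqtop UNIV) X) \<psi>"
    using hom by (auto simp: homeomorphic_maps_def)
  obtain m where "block_code X m \<phi>" using sliding_block_code[OF X c(1) \<phi>_shift] by blast
  moreover obtain k where "block_code Y k \<psi>" using sliding_block_code[OF Y c(2) \<psi>_shift] by blast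
  ultimately show thesis
    using that[of "max m k"] block_code_mono max.cobounded1 max.cobounded2 by metis
qed

text \<open>A block code looks at most \<open>m\<close> places ahead, so agreement up to
  \<open>- k\<close> becomes agreement up to \<open>- (k + m)\<close>.\<close>

lemma leaf_image:
  assumes x: "x \<in> X" and z: "z \<in> leaf X x"
  shows "\<phi> z \<in> leaf Y (\<phi> x)"
proof -
  obtain m where m: "block_code X m \<phi>" "block_code Y m \<psi>"
    by (rule common_window)
  obtain k :: nat where k: "z \<in> X" "\<forall>j\<le>- int k. z j = x j"
    using z by (auto simp: mem_leaf_iff)
  have "\<phi> z j = \<phi> x j" if "j \<le> - int (k + m)" for j
    using k x that by (intro block_codeD[OF m(1)]) auto
  then show ?thesis using k maps unfolding mem_leaf_iff by blast
qed

text \<open>Both leaves carry the Borel sets of the subspace topology, so continuity of the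
  restricted conjugacy suffices.\<close>

lemma measurable_leaf:
  assumes x: "x \<in> X" and L: "is_lambda X g x L" and L': "is_lambda Y g' (\<phi> x) L'"
  shows "\<phi> \<in> L \<rightarrow>\<^sub>M L'"
proof -
  let ?T = "subtopology (seqtop UNIV) (leaf X x)" and ?T' = "subtopology (seqtop UNIV) (leaf Y (\<phi> x))"
  have "leaf X x \<subseteq> X" by (auto simp: mem_leaf_iff)
  then have "continuous_map ?T (seqtop UNIV) \<phi>"
    using hom continuous_map_from_subtopology_mono
    by (auto simp: homeomorphic_maps_def continuous_map_in_subtopology)
  then have "continuous_map ?T ?T' \<phi>"
    using leaf_image[OF x] by (auto simp: continuous_map_in_subtopology)
  then show ?thesis
    using measurable_borel_on L L' measurable_cong_sets[of L "borel_on ?T" L' "borel_on ?T'"]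
    by (auto simp: is_lambda_def)
qed

text \<open>The collected words sit on \<open>{- m<..m + length b}\<close>. Preceded by
  \<open>u\<close> on \<open>{- 3m<..- m}\<close>, they fill the windows of all coordinates in
  \<open>{- 2m<..length b}\<close>, so they decide the condition on the image. The empty
  \<open>b\<close> describes the conditioning event.\<close>

definition code_words :: "nat \<Rightarrow> 'a list \<Rightarrow> 'b list \<Rightarrow> 'b list \<Rightarrow> 'a list set" where
  "code_words m u v b =
     {word (- int m) (2 * m + length b) z | z. z \<in> X \<and>
        word (- 3 * int m) (2 * m) z = u \<and> word (- 2 * int m) (2 * m + length b) (\<phi> z) = v @ b}"

text \<open>In one direction the window of \<open>\<psi>\<close> turns agreement of the images up to
  0 into agreement of the points up to \<open>- m\<close>. In the other, the window of
  \<open>\<phi>\<close> gives agreement of the images up to \<open>- 2m\<close>, and the second word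
  supplies the gap \<open>{- 2m<..0}\<close>.\<close>

lemma vimage_cylinder:
  assumes m: "block_code X m \<phi>" "block_code Y m \<psi>"
    and x: "x \<in> X"
  shows "\<phi> -` cylinder (fiber Y 0 (restrict (\<phi> x) {..0})) 0 b \<inter> leaf X x =
    (\<Union>a\<in>code_words m (word (- 3 * int m) (2 * m) x) (word (- 2 * int m) (2 * m) (\<phi> x)) b.
       cylinder (fiber X (- int m) (restrict x {..- int m})) (- int m) a)"
    (is "?A = (\<Union>a\<in>?W. ?C a)")
proof (intro set_eqI iffI)
  fix z assume "z \<in> ?A"
  then have z: "z \<in> X" and past: "\<forall>j\<le>0. \<phi> z j = \<phi> x j" and b: "word 0 (length b) (\<phi> z) = b"
    by (auto simp: cylinder_def mem_fiber_iff mem_leaf_iff)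
  have eq: "z j = x j" if "j \<le> - int m" for j
    using block_codeD[OF m(2), of "\<phi> z" "\<phi> x" j] past z x maps that by auto
  have "word (- 2 * int m) (2 * m) (\<phi> z) = word (- 2 * int m) (2 * m) (\<phi> x)"
    using past by (auto simp: word_eq_iff)
  then have "word (- 2 * int m) (2 * m + length b) (\<phi> z) = word (- 2 * int m) (2 * m) (\<phi> x) @ b"
    using b by (simp add: word_append)
  moreover have "word (- 3 * int m) (2 * m) z = word (- 3 * int m) (2 * m) x"
    using eq by (auto simp: word_eq_iff)
  ultimately have "word (- int m) (2 * m + length b) z \<in> ?W"
    using z by (auto simp: code_words_def)
  moreover have "z \<in> ?C (word (- int m) (2 * m + length b) z)"
    using z eq by (auto simp: cylinder_def mem_fiber_iff)
  ultimately show "z \<in> (\<Union>a\<in>?W. ?C a)" by blast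
next
  fix z assume "z \<in> (\<Union>a\<in>?W. ?C a)"
  then obtain a where a: "a \<in> ?W" "z \<in> ?C a" by blast
  obtain w where w: "w \<in> X" "word (- 3 * int m) (2 * m) w = word (- 3 * int m) (2 * m) x"
    "word (- 2 * int m) (2 * m + length b) (\<phi> w) = word (- 2 * int m) (2 * m) (\<phi> x) @ b"
    and aw: "a = word (- int m) (2 * m + length b) w"
    using a by (auto simp: code_words_def)
  have z: "z \<in> X" "\<And>j. j \<le> - int m \<Longrightarrow> z j = x j"
    and za: "word (- int m) (2 * m + length b) z = word (- int m) (2 * m + length b) w"
    using a(2) aw by (auto simp: cylinder_def mem_fiber_iff)
  \<comment> \<open>The witness \<open>w\<close> need not share the past of \<open>x\<close> beyond
    the word \<open>u\<close>, so \<open>z\<close> is compared with it on this finite stretch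
    only.\<close>
  have zw: "z l = w l" if "- 3 * int m < l" "l \<le> int m + int (length b)" for l
  proof (cases "l \<le> - int m")
    case True then show ?thesis using z(2)[of l] w(2) that by (auto simp: word_eq_iff)
  next
    case False then show ?thesis using za that by (auto simp: word_eq_iff)
  qed
  have \<phi>zw: "\<phi> z j = \<phi> w j" if "- 2 * int m < j" "j \<le> int (length b)" for j
    using that z w by (intro block_codeD[OF m(1)]) (auto intro!: zw)
  have \<phi>w: "word (- 2 * int m) (2 * m) (\<phi> w) = word (- 2 * int m) (2 * m) (\<phi> x)"
    "word 0 (length b) (\<phi> w) = b"
    using w(3) unfolding word_append by simp_all
  have "\<phi> z j = \<phi> x j" if "j \<le> 0" for j
  proof (cases "j \<le> - 2 * int m")
    case True then show ?thesis using z x by (intro block_codeD[OF m(1)]) auto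
  next
    case False then show ?thesis using \<phi>w(1) \<phi>zw[of j] that by (auto simp: word_eq_iff)
  qed
  moreover have "word 0 (length b) (\<phi> z) = b"
    using \<phi>w(2) \<phi>zw word_eq_iff[of 0 "length b" "\<phi> z" "\<phi> w"] by auto
  moreover have "z \<in> leaf X x" using a(2) fiber_subset_leaf by (auto simp: cylinder_def)
  ultimately show "z \<in> ?A" using z maps by (auto simp: cylinder_def mem_fiber_iff)
qed

text \<open>This is a conditional probability. Evaluating the transported leaf measure on the
  cylinder of \<open>b\<close> leaves the unknown factor \<open>c\<close> and the masses of the two
  fibres; dividing by the case of the empty word removes them.\<close>

lemma word_prob_image:
  assumes m: "block_code X m \<phi>" "block_code Y m \<psi>"
    and x: "x \<in> X"
    and L: "is_lambda X g x L" and L': "is_lambda Y g' (\<phi> x) L'"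
    and c: "c > 0" and distr: "distr L L' \<phi> = scale_measure (ennreal c) L'"
  defines "W \<equiv> code_words m (word (- 3 * int m) (2 * m) x) (word (- 2 * int m) (2 * m) (\<phi> x))"
  shows "word_prob Y g' 0 (\<phi> x) b =
    (\<Sum>a\<in>W b. word_prob X g (- int m) x a) / (\<Sum>a\<in>W []. word_prob X g (- int m) x a)"
proof -
  let ?F = "fiber X (- int m) (restrict x {..- int m})"
    and ?G = "fiber Y 0 (restrict (\<phi> x) {..0})"
  let ?S = "\<lambda>b. \<Sum>a\<in>W b. word_prob X g (- int m) x a"
  have S: "c * measure L' (cylinder ?G 0 b) = measure L ?F * ?S b" for b
  proof -
    \<comment> \<open>A common length makes the set of words finite and their cylinders
      disjoint.\<close>
    have len: "length a = 2 * m + length b" if "a \<in> W b" for a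
      using that by (auto simp: W_def code_words_def)
    have "W b \<subseteq> {a. set a \<subseteq> UNIV \<and> length a = 2 * m + length b}" using len by auto
    then have fin: "finite (W b)"
      by (rule finite_subset) (intro finite_lists_length_eq finite)
    have dis: "disjoint_family_on (cylinder ?F (- int m)) (W b)"
      using len by (auto simp: disjoint_family_on_def cylinder_def)
    have sets: "cylinder ?F (- int m) a \<in> sets L" for a using is_lambdaD(3)[OF L] .
    have finm: "emeasure L (cylinder ?F (- int m) a) \<noteq> \<infinity>" for a
    proof -
      have "emeasure L (cylinder ?F (- int m) a) \<le> emeasure L (cylinder ?F (- int m) [])"
        by (intro emeasure_mono sets) (auto simp: cylinder_def word_def)
      then show ?thesis using is_lambdaD(1)[OF L, of "- int m"] by (auto simp: top_unique)
    qed
    have "c * measure L' (cylinder ?G 0 b) = measure (distr L L' \<phi>) (cylinder ?G 0 b)"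
      using c distr by simp
    also have "\<dots> = measure L (\<phi> -` cylinder ?G 0 b \<inter> leaf X x)"
      using measure_distr[OF measurable_leaf[OF x L L'] is_lambdaD(3)[OF L']] L
      by (simp add: is_lambda_def)
    also have "\<dots> = (\<Sum>a\<in>W b. measure L (cylinder ?F (- int m) a))"
      unfolding vimage_cylinder[OF m x] W_def[symmetric]
      using fin sets dis finm by (intro measure_finite_Union) auto
    also have "\<dots> = measure L ?F * ?S b"
      unfolding is_lambdaD(4)[OF L] by (simp add: sum_distrib_left)
    finally show ?thesis .
  qed
  have b: "c * measure L' ?G * word_prob Y g' 0 (\<phi> x) b = measure L ?F * ?S b"
    using S[of b] unfolding is_lambdaD(4)[OF L'] by simp
  \<comment> \<open>The cylinder of the empty word is the whole fibre. Its positive mass also shows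
    that the denominator does not vanish.\<close>
  have G: "c * measure L' ?G = measure L ?F * ?S []" using S[of "[]"] by simp
  have F: "measure L ?F > 0" and "c * measure L' ?G > 0"
    using is_lambdaD(2)[OF L', of 0] is_lambdaD(2)[OF L, of "- int m"] c by auto
  then have "?S [] \<noteq> 0" unfolding G by auto
  moreover have "?S [] * word_prob Y g' 0 (\<phi> x) b = ?S b" using b F unfolding G by simp
  ultimately show ?thesis by (simp add: eq_divide_eq mult.commute)
qed

text \<open>The ratio involves \<open>x\<close> only through its law over \<open>{..- int m}\<close>
  and two words of length \<open>2 * m\<close>. That law is the one over \<open>{..0}\<close> at
  \<open>shift (- int m) x\<close>, which again lies in \<open>E_set\<close>.\<close>

lemma word_prob_image_factors:
  assumes image: "\<phi> ` E_set X D g = E_set Y D' g'"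
    and L: "\<And>x. x \<in> E_set X D g \<Longrightarrow> \<exists>L L' c. is_lambda X g x L \<and> is_lambda Y g' (\<phi> x) L' \<and>
      c > 0 \<and> distr L L' \<phi> = scale_measure (ennreal c) L'"
  obtains A :: "('a list \<times> 'b list) set" and k where "finite A"
    "word_prob Y g' 0 ` E_set Y D' g' \<subseteq> k ` (word_prob X g 0 ` E_set X D g \<times> A)"
proof -
  obtain m where m: "block_code X m \<phi>" "block_code Y m \<psi>"
    by (rule common_window)
  let ?A = "{u :: 'a list. set u \<subseteq> UNIV \<and> length u = 2 * m} \<times> {v :: 'b list. set v \<subseteq> UNIV \<and> length v = 2 * m}"
  let ?k = "\<lambda>(p, u, v) b. (\<Sum>a\<in>code_words m u v b. p a) / (\<Sum>a\<in>code_words m u v []. p a)"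
  have "word_prob Y g' 0 (\<phi> x) \<in> ?k ` (word_prob X g 0 ` E_set X D g \<times> ?A)" if x: "x \<in> E_set X D g" for x
  proof -
    have xX: "x \<in> X" using x by (simp add: E_set_def)
    obtain L L' c where "is_lambda X g x L" "is_lambda Y g' (\<phi> x) L'" "c > 0"
      "distr L L' \<phi> = scale_measure (ennreal c) L'" using L[OF x] by blast
    from word_prob_image[OF m xX this]
    have "word_prob Y g' 0 (\<phi> x) = ?k (word_prob X g 0 (shift (- int m) x),
        word (- 3 * int m) (2 * m) x, word (- 2 * int m) (2 * m) (\<phi> x))" (is "_ = ?k ?t")
      by (auto simp: word_prob_shift[OF X] fun_eq_iff)
    moreover have "?t \<in> word_prob X g 0 ` E_set X D g \<times> ?A"
      by (simp add: E_set_shift[OF X x])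
    ultimately show ?thesis by (rule image_eqI)
  qed
  then have "word_prob Y g' 0 ` E_set Y D' g' \<subseteq> ?k ` (word_prob X g 0 ` E_set X D g \<times> ?A)"
    unfolding image[symmetric] by blast
  moreover have "finite ?A" by (intro finite_cartesian_product finite_lists_length_eq) auto
  ultimately show thesis by (rule that[rotated])
qed

lemma mu_range_image:
  assumes image: "\<phi> ` E_set X D g = E_set Y D' g'"
    and L: "\<And>x. x \<in> E_set X D g \<Longrightarrow> \<exists>L L' c. is_lambda X g x L \<and> is_lambda Y g' (\<phi> x) L' \<and>
      c > 0 \<and> distr L L' \<phi> = scale_measure (ennreal c) L'"
  shows "finite (mu_range X D g) \<Longrightarrow> finite (mu_range Y D' g')"
    and "countable (mu_range X D g) \<Longrightarrow> countable (mu_range Y D' g')"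
proof -
  obtain A :: "('a list \<times> 'b list) set" and k where A: "finite A"
    "word_prob Y g' 0 ` E_set Y D' g' \<subseteq> k ` (word_prob X g 0 ` E_set X D g \<times> A)"
    using word_prob_image_factors[OF image L] by blast
  \<comment> \<open>The leaf measures supply the fibre measures that
    \<open>mu_range_card_iff\<close> requires, here and on the side of \<open>Y\<close>.\<close>
  have X_mu: "\<exists>M. is_mu X g 0 (restrict x {..0}) M" if "x \<in> E_set X D g" for x
    using L[OF that] is_lambdaD(5) by blast
  have Y_mu: "\<exists>M. is_mu Y g' 0 (restrict y {..0}) M" if y: "y \<in> E_set Y D' g'" for y
  proof -
    obtain x where "x \<in> E_set X D g" "y = \<phi> x" using y image by blast
    then show ?thesis using L is_lambdaD(5) by blast
  qed
  note muX = mu_range_card_iff[of X D g, OF X_mu] and muY = mu_range_card_iff[of Y D' g', OF Y_mu]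
  show "finite (mu_range X D g) \<Longrightarrow> finite (mu_range Y D' g')"
    using finite_subset[OF A(2)] A(1) by (simp add: muX muY)
  show "countable (mu_range X D g) \<Longrightarrow> countable (mu_range Y D' g')"
    using countable_subset[OF A(2)] A(1) by (simp add: muX muY countable_finite)
qed

end

section \<open>Invariance under conjugacy, by transport in both directions\<close>

theorem theorem3p4:
  fixes X :: "(int \<Rightarrow> 'a::finite) set" and Y :: "(int \<Rightarrow> 'b::finite) set"
    and D :: "(int \<Rightarrow> 'a) set" and g :: "(int \<Rightarrow> 'a) \<Rightarrow> 'a \<Rightarrow> real"
    and D' :: "(int \<Rightarrow> 'b) set" and g' :: "(int \<Rightarrow> 'b) \<Rightarrow> 'b \<Rightarrow> real"
    and \<phi> :: "(int \<Rightarrow> 'a) \<Rightarrow> (int \<Rightarrow> 'b)"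
  assumes "subshift X" and "property_D X"
    and "subshift Y" and "property_D Y"
    and "residual_g_function X D g"
    and "residual_g_function Y D' g'"
    and "conjugacy X Y \<phi>"
    and "is_image X D g Y D' g' \<phi>"
  shows "(finite (mu_range X D g) \<longleftrightarrow> finite (mu_range Y D' g')) \<and>
         (countable (mu_range X D g) \<and> infinite (mu_range X D g) \<longleftrightarrow>
          countable (mu_range Y D' g') \<and> infinite (mu_range Y D' g'))"
proof -
  note X = \<open>subshift X\<close> and Y = \<open>subshift Y\<close>
  define \<psi> where "\<psi> = inv_into X \<phi>"
  let ?TX = "subtopology (seqtop UNIV) X" and ?TY = "subtopology (seqtop UNIV) Y"
  have h: "homeomorphic_map ?TX ?TY \<phi>"
    and \<phi>_shift: "\<And>x. x \<in> X \<Longrightarrow> \<phi> (shift 1 x) = shift 1 (\<phi> x)"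
    using \<open>conjugacy X Y \<phi>\<close> unfolding conjugacy_def by blast+
  have inj: "inj_on \<phi> X" using homeomorphic_imp_injective_map[OF h] by simp
  obtain \<phi>' where \<phi>': "homeomorphic_maps ?TX ?TY \<phi> \<phi>'" using h homeomorphic_map_maps by blast
  \<comment> \<open>\<open>is_image\<close> is stated with \<open>inv_into\<close>, so the
    topological inverse has to be identified with it on \<open>Y\<close>.\<close>
  have hom: "homeomorphic_maps ?TX ?TY \<phi> \<psi>"
  proof (rule homeomorphic_maps_eq[OF \<phi>'])
    show "\<phi>' y = \<psi> y" if "y \<in> topspace ?TY" for y
    proof -
      have "\<phi>' y \<in> X" "\<phi> (\<phi>' y) = y"
        using \<phi>' that by (auto simp: homeomorphic_maps_def continuous_map_def)
      then show ?thesis using inv_into_f_f[OF inj, of "\<phi>' y"] by (simp add: \<psi>_def)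
    qed
  qed simp
  have \<psi>: "\<psi> y \<in> X" "\<phi> (\<psi> y) = y" if "y \<in> Y" for y
    using hom that by (auto simp: homeomorphic_maps_def continuous_map_def)
  have \<psi>_shift: "\<psi> (shift 1 y) = shift 1 (\<psi> y)" if "y \<in> Y" for y
    using \<phi>_shift[OF \<psi>(1)[OF that]] \<psi>[OF that] subshift_shift[OF X]
    by (metis \<psi>_def inj inv_into_f_f)
  interpret XY: conjugate_pair X Y \<phi> \<psi>
    by (rule conjugate_pair.intro[OF X Y hom \<phi>_shift \<psi>_shift])
  interpret YX: conjugate_pair Y X \<psi> \<phi> by (rule XY.swap)
  have image: "\<phi> ` E_set X D g = E_set Y D' g'"
    and lam: "\<And>x. x \<in> E_set X D g \<Longrightarrow> \<exists>L L'. is_lambda X g x L \<and> is_lambda Y g' (\<phi> x) L' \<and>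
      (\<exists>c::real. c > 0 \<and> distr L' L \<psi> = scale_measure (ennreal c) L)"
    using \<open>is_image X D g Y D' g' \<phi>\<close> unfolding is_image_def \<psi>_def by blast+
  have EX: "x \<in> X" if "x \<in> E_set X D g" for x using that by (simp add: E_set_def)
  have image': "\<psi> ` E_set Y D' g' = E_set X D g"
    unfolding image[symmetric] image_image using EX XY.maps by force
  \<comment> \<open>\<open>is_image\<close> pushes the measure of \<open>Y\<close> back along
    \<open>\<psi>\<close>, while the locale results push forward along \<open>\<phi>\<close>.
    Inverting the relation replaces \<open>c\<close> by \<open>1 / c\<close>.\<close>
  have lam1: "\<exists>L L' c. is_lambda X g x L \<and> is_lambda Y g' (\<phi> x) L' \<and>
      c > 0 \<and> distr L L' \<phi> = scale_measure (ennreal c) L'" if x: "x \<in> E_set X D g" for x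
  proof -
    obtain L L' and c :: real where L: "is_lambda X g x L" and L': "is_lambda Y g' (\<phi> x) L'"
      and c: "c > 0" and d: "distr L' L \<psi> = scale_measure (ennreal c) L" using lam[OF x] by blast
    have \<phi>m: "\<phi> \<in> L \<rightarrow>\<^sub>M L'" using XY.measurable_leaf[OF EX[OF x] L L'] .
    have \<psi>m: "\<psi> \<in> L' \<rightarrow>\<^sub>M L"
      using YX.measurable_leaf[of "\<phi> x" g' L' g L] L L' EX[OF x] XY.maps by simp
    have "distr L L' \<phi> = scale_measure (ennreal (1 / c)) L'"
    proof (rule measure_eqI)
      fix B assume "B \<in> sets (distr L L' \<phi>)"
      then have B: "B \<in> sets L'" by simp
      let ?A = "\<phi> -` B \<inter> space L"
      have A: "?A \<in> sets L" using \<phi>m B by (rule measurable_sets)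
      have "\<psi> -` ?A \<inter> space L' = B"
      proof -
        have "space L' \<subseteq> Y" using L' by (auto simp: is_lambda_def mem_leaf_iff)
        then show ?thesis
          using sets.sets_into_space[OF B] measurable_space[OF \<psi>m] XY.maps(4) by fastforce
      qed
      then have "emeasure L' B = ennreal c * emeasure L ?A"
        using emeasure_distr[OF \<psi>m A] d by simp
      then have "ennreal (1 / c) * emeasure L' B = (ennreal (1 / c) * ennreal c) * emeasure L ?A"
        by (simp add: mult.assoc)
      also have "ennreal (1 / c) * ennreal c = 1"
        using c by (simp add: ennreal_mult[symmetric])
      finally show "emeasure (distr L L' \<phi>) B = emeasure (scale_measure (ennreal (1 / c)) L') B"
        using emeasure_distr[OF \<phi>m B] by simp
    qed simp
    then show ?thesis using L L' c by (intro exI[of _ L] exI[of _ L'] exI[of _ "1 / c"]) simp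
  qed
  \<comment> \<open>For the converse the relation already has the right direction; only the base
    point is renamed.\<close>
  have lam2: "\<exists>L' L c. is_lambda Y g' y L' \<and> is_lambda X g (\<psi> y) L \<and>
      c > 0 \<and> distr L' L \<psi> = scale_measure (ennreal c) L" if "y \<in> E_set Y D' g'" for y
  proof -
    obtain x where "x \<in> E_set X D g" "y = \<phi> x" using \<open>y \<in> E_set Y D' g'\<close> image by blast
    then show ?thesis using lam[of x] EX XY.maps(3) by auto
  qed
  show ?thesis
    using XY.mu_range_image[OF image lam1] YX.mu_range_image[OF image' lam2] by blast
qed

end
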